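(* Let $(G,\mu)$ be a countable measured group and suppose $(X,\nu)$ is a $(G,\mu)$-space which admits a product current $\rho$. Given $\varepsilon>0$ and an integer $n\ge 1$, define $$\tau_{\varepsilon,n}=\operatorname{ess\,sup}_{x\in X}\int_G\sigma_\nu(g,x)^{1-2\varepsilon}\,d\mu^{*n}(g).$$ Then $N_{\rho,\varepsilon}(Q_\mu^n u)\le\tau_{\varepsilon,n}\cdot N_{\rho,\varepsilon}(u)$ for all $u\in\mathcal{B}_{\rho,\varepsilon}$.
   Context: A measured group $(G,\mu)$ is a countable group $G$ with a probability measure $\mu$ whose support generates $G$ as a semigroup; $\mu^{*n}$ is the $n$-th convolution power. Here $(X,\nu)$ is a compact $(G,\mu)$-space: $X$ is a compact metrizable space with an action of $G$ by homeomorphisms and $\nu$ is a Borel probability measure, whose measure class is preserved by $G$, such that $\int_G\int_X\phi(s^{-1}x)\,d\nu(x)\,d\mu(s)=\int_X\phi\,d\nu$ for all $\phi\in C(X)$. The Radon–Nikodym cocycle is $\sigma_\nu(g,x)=\frac{dg^{-1}\nu}{d\nu}(x)$, where $g^{-1}\nu$ is the push-forward of $\nu$ under $x\mapsto g^{-1}x$; thus $\int_X\phi(g^{-1}x)\,d\nu(x)=\int_X\phi(x)\sigma_\nu(g,x)\,d\nu(x)$. Suppose $\nu$ is non-atomic, so that $\nu\otimes\nu$ is a probability measure on $\partial^2X=(X\times X)\setminus\Delta X$, where $\Delta X$ is the diagonal. A product current for $(X,\nu)$ is a non-negative Borel measurable function $\rho$ on $\partial^2X$ such that the (possibly infinite)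 measure $\rho(x,y)\,d\nu(x)\,d\nu(y)$ on $\partial^2X$ is invariant under the diagonal $G$-action; equivalently, for all $g\in G$, $\rho(gx,gy)\,\sigma_\nu(g,x)\,\sigma_\nu(g,y)=\rho(x,y)$ for $\nu\otimes\nu$-almost every $(x,y)$. For $\varepsilon>0$ and $u\in L^\infty(X,\nu)$ put $$N_{\rho,\varepsilon}(u)=\int_{\partial^2X}|u(x)-u(y)|\,\rho(x,y)^{\frac12+\varepsilon}\,d\nu(x)\,d\nu(y),$$ and $\mathcal{B}_{\rho,\varepsilon}=\{u\in L^\infty(X,\nu):N_{\rho,\varepsilon}(u)<\infty\}$. The convolution operator is $Q_\mu u(x)=\int_G u(g^{-1}x)\,d\mu(g)$. (If $\tau_{\varepsilon,n}=\infty$, the product $\infty\cdot0$ is read as $0$.) *)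

theory Defs
  imports "HOL-Probability.Probability" "HOL-Algebra.Group_Action"
begin

section \<open>Measured groups\<close>

inductive_set semigroup_span :: "('g, 'm) monoid_scheme \<Rightarrow> 'g set \<Rightarrow> 'g set"
  for G (structure) and S where
  incl: "s \<in> S \<Longrightarrow> s \<in> semigroup_span G S"
| mult: "\<lbrakk>a \<in> semigroup_span G S; b \<in> semigroup_span G S\<rbrakk> \<Longrightarrow> a \<otimes> b \<in> semigroup_span G S"

locale measured_group = group G for G (structure) +
  fixes \<mu> :: "'a pmf"
  assumes countable_carrier: "countable (carrier G)"
    and supp_subset: "set_pmf \<mu> \<subseteq> carrier G"
    and supp_generates: "semigroup_span G (set_pmf \<mu>) = carrier G"

definition convolution :: "('g, 'm) monoid_scheme \<Rightarrow> 'g pmf \<Rightarrow> 'g pmf \<Rightarrow> 'g pmf" where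
  "convolution G p q = bind_pmf p (\<lambda>g. map_pmf (\<lambda>h. g \<otimes>\<^bsub>G\<^esub> h) q)"

primrec conv_power :: "('g, 'm) monoid_scheme \<Rightarrow> 'g pmf \<Rightarrow> nat \<Rightarrow> 'g pmf" where
  "conv_power G \<mu> 0 = return_pmf \<one>\<^bsub>G\<^esub>"
| "conv_power G \<mu> (Suc n) = convolution G \<mu> (conv_power G \<mu> n)"

section \<open>Compact spaces with a stationary measure\<close>

text \<open>The space \<open>X\<close> is the type \<open>'x\<close>; \<open>act g x\<close> stands for \<open>gx\<close>.
  The stationarity condition involves \<open>s\<^sup>-\<^sup>1 x\<close>, not \<open>s x\<close>.\<close>

locale compact_measured_group_space =
  measured_group G \<mu> + group_action G "UNIV :: 'x set" act + prob_space \<nu>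
  for G (structure) and \<mu> and act :: "'g \<Rightarrow> 'x::topological_space \<Rightarrow> 'x"
    and \<nu> :: "'x measure" +
  assumes compact_UNIV: "compact (UNIV :: 'x set)"
    and metrizable: "metrizable_space (euclidean :: 'x topology)"
    and act_homeomorphism:
      "g \<in> carrier G \<Longrightarrow> homeomorphism UNIV UNIV (act g) (act (inv g))"
    and sets_borel: "sets \<nu> = sets borel"
    and measure_class_preserved:
      "g \<in> carrier G \<Longrightarrow> null_sets (distr \<nu> borel (act g)) = null_sets \<nu>"
    and stationary:
      "continuous_on UNIV (\<phi> :: 'x \<Rightarrow> real) \<Longrightarrow>
        (\<integral>s. (\<integral>x. \<phi> (act (inv s) x) \<partial>\<nu>) \<partial>measure_pmf \<mu>) = (\<integral>x. \<phi> x \<partial>\<nu>)"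

text \<open>The Radon--Nikodym cocycle \<open>\<sigma>\<^sub>\<nu>(g,x) = d(g\<^sup>-\<^sup>1 \<nu>)/d\<nu> (x)\<close>. Under the assumptions above
  the derivative is positive and finite almost everywhere, so that converting it to a real
  number changes it on a null set only.\<close>

definition rn_cocycle ::
  "('g, 'm) monoid_scheme \<Rightarrow> ('g \<Rightarrow> 'x::topological_space \<Rightarrow> 'x) \<Rightarrow> 'x measure \<Rightarrow> 'g \<Rightarrow> 'x \<Rightarrow> real"
  where "rn_cocycle G act \<nu> g x = enn2real (RN_deriv \<nu> (distr \<nu> borel (act (inv\<^bsub>G\<^esub> g))) x)"

definition nonatomic :: "'a measure \<Rightarrow> bool" where
  "nonatomic M \<longleftrightarrow>
    (\<forall>A\<in>sets M. 0 < emeasure M A \<longrightarrow>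
      (\<exists>B\<in>sets M. B \<subseteq> A \<and> 0 < emeasure M B \<and> emeasure M B < emeasure M A))"

section \<open>Product currents\<close>

definition offdiag :: "('x \<times> 'x) set" where
  "offdiag = {(x, y). x \<noteq> y}"

definition offdiag_measure :: "'x measure \<Rightarrow> ('x \<times> 'x) measure" where
  "offdiag_measure \<nu> = restrict_space (\<nu> \<Otimes>\<^sub>M \<nu>) offdiag"

text \<open>Only the values of \<open>\<rho>\<close> off the diagonal matter.\<close>

definition product_current ::
  "('g, 'm) monoid_scheme \<Rightarrow> ('g \<Rightarrow> 'x::topological_space \<Rightarrow> 'x) \<Rightarrow> 'x measure
    \<Rightarrow> ('x \<times> 'x \<Rightarrow> real) \<Rightarrow> bool" where
  "product_current G act \<nu> \<rho> \<longleftrightarrow>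
    \<rho> \<in> borel_measurable (restrict_space borel offdiag) \<and>
    (\<forall>p\<in>offdiag. 0 \<le> \<rho> p) \<and>
    (\<forall>g\<in>carrier G.
      distr (density (offdiag_measure \<nu>) (\<lambda>p. ennreal (\<rho> p))) (offdiag_measure \<nu>)
        (\<lambda>(x, y). (act g x, act g y))
      = density (offdiag_measure \<nu>) (\<lambda>p. ennreal (\<rho> p)))"

section \<open>The seminorms, the convolution operator and the constants\<close>

text \<open>Elements of \<open>L\<^sup>\<infinity>(X,\<nu>)\<close> are represented by functions. The scalar type \<open>'k\<close> can be
  instantiated with the real as well as with the complex numbers.\<close>

definition L_infinity :: "'x measure \<Rightarrow> ('x \<Rightarrow> 'k::real_normed_field) set" where
  "L_infinity \<nu> = {u \<in> borel_measurable \<nu>. \<exists>C. AE x in \<nu>. norm (u x) \<le> C}"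

definition N_seminorm ::
  "'x measure \<Rightarrow> ('x \<times> 'x \<Rightarrow> real) \<Rightarrow> real \<Rightarrow> ('x \<Rightarrow> 'k::real_normed_field) \<Rightarrow> ennreal" where
  "N_seminorm \<nu> \<rho> \<epsilon> u =
    (\<integral>\<^sup>+(x, y). ennreal (norm (u x - u y) * \<rho> (x, y) powr (1 / 2 + \<epsilon>)) \<partial>offdiag_measure \<nu>)"

definition B_space ::
  "'x measure \<Rightarrow> ('x \<times> 'x \<Rightarrow> real) \<Rightarrow> real \<Rightarrow> ('x \<Rightarrow> 'k::real_normed_field) set" where
  "B_space \<nu> \<rho> \<epsilon> = {u \<in> L_infinity \<nu>. N_seminorm \<nu> \<rho> \<epsilon> u < \<infinity>}"

definition conv_operator ::
  "('g, 'm) monoid_scheme \<Rightarrow> ('g \<Rightarrow> 'x \<Rightarrow> 'x) \<Rightarrow> 'g pmf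
    \<Rightarrow> ('x \<Rightarrow> 'k::{real_normed_field, banach, second_countable_topology}) \<Rightarrow> 'x \<Rightarrow> 'k" where
  "conv_operator G act \<mu> u x = (\<integral>g. u (act (inv\<^bsub>G\<^esub> g) x) \<partial>measure_pmf \<mu>)"

definition tau ::
  "('g, 'm) monoid_scheme \<Rightarrow> 'g pmf \<Rightarrow> ('g \<Rightarrow> 'x::topological_space \<Rightarrow> 'x) \<Rightarrow> 'x measure
    \<Rightarrow> real \<Rightarrow> nat \<Rightarrow> ennreal" where
  "tau G \<mu> act \<nu> \<epsilon> n =
    esssup \<nu> (\<lambda>x. \<integral>\<^sup>+g. ennreal (rn_cocycle G act \<nu> g x powr (1 - 2 * \<epsilon>))
      \<partial>measure_pmf (conv_power G \<mu> n))"

end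

theory Submission
  imports Defs
begin

text \<open>By the triangle inequality, \<open>N(Q\<^sup>n u)\<close> is at most the \<open>\<mu>\<^sup>*\<^sup>n\<close>-average of the integrals
  of \<open>|u(g\<^sup>-\<^sup>1x) - u(g\<^sup>-\<^sup>1y)| \<rho>(x,y)\<^sup>a\<close> with \<open>a = 1/2 + \<epsilon>\<close>. Substituting \<open>(gx, gy)\<close> for \<open>(x, y)\<close>
  turns the weight into \<open>\<rho>(gx,gy)\<^sup>a \<sigma>(g,x) \<sigma>(g,y)\<close>, which by the cocycle identity for \<open>\<rho>\<close> equals
  \<open>\<rho>(x,y)\<^sup>a (\<sigma>(g,x) \<sigma>(g,y))\<^bsup>1/2 - \<epsilon>\<^esup>\<close>. By the AM-GM inequality the last factor is at most the mean
  of \<open>\<sigma>(g,x)\<^bsup>1 - 2\<epsilon>\<^esup>\<close> and \<open>\<sigma>(g,y)\<^bsup>1 - 2\<epsilon>\<^esup>\<close>; averaging over \<open>g\<close> bounds this by \<open>\<tau>\<close>.\<close>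

section \<open>Second countability and Borel sets of the square\<close>

text \<open>The type of \<open>X\<close> is only a topological space, so second countability has to
  come from compactness and metrizability: compactness gives finite nets at every scale
  \<open>inverse (Suc n)\<close>, and the balls around their points form a base.\<close>

lemma compact_metrizable_countable_base:
  assumes "compact (UNIV :: 'x::topological_space set)"
    and "metrizable_space (euclidean :: 'x::topological_space topology)"
  obtains B :: "'x::topological_space set set" where "countable B" "\<And>b. b \<in> B \<Longrightarrow> open b"
    "\<And>x U. open U \<Longrightarrow> x \<in> U \<Longrightarrow> \<exists>b\<in>B. x \<in> b \<and> b \<subseteq> U"
proof -
  obtain M and d :: "'x \<Rightarrow> 'x \<Rightarrow> real" where "Metric_space M d"
    and top: "(euclidean :: 'x topology) = Metric_space.mtopology M d"
    using assms(2) unfolding metrizable_space_def by blast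
  then interpret Metric_space M d by simp
  have M: "M = UNIV"
    using arg_cong[OF top, of topspace] by simp
  have op: "open U \<longleftrightarrow> openin mtopology U" for U :: "'x set"
    by (simp flip: top)
  have "compactin mtopology UNIV"
    using assms(1) by (simp flip: top)
  then have "mtotally_bounded UNIV"
    by (rule compactin_imp_mtotally_bounded)
  then have "\<exists>K. finite K \<and> UNIV \<subseteq> (\<Union>x\<in>K. mball x (inverse (Suc n)))" for n
    unfolding mtotally_bounded_def by (metis inverse_Suc)
  then obtain K where K: "\<And>n. finite (K n)" "\<And>n. UNIV \<subseteq> (\<Union>x\<in>K n. mball x (inverse (Suc n)))"
    by metis
  define B where "B = (\<Union>n. (\<lambda>x. mball x (inverse (Suc n))) ` K n)"
  show thesis
  proof
    show "countable B"
      unfolding B_def using K(1) by (auto intro: countable_finite)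
    show "open b" if "b \<in> B" for b
      using that by (auto simp: B_def op)
    show "\<exists>b\<in>B. x \<in> b \<and> b \<subseteq> U" if "open U" "x \<in> U" for x U
    proof -
      obtain r where r: "r > 0" "mball x r \<subseteq> U"
        using \<open>open U\<close> \<open>x \<in> U\<close> unfolding op openin_mtopology by blast
      \<comment> \<open>Half of \<open>r\<close>: a ball of this radius that contains
        \<open>x\<close> has every point at distance less than \<open>r\<close> from
        \<open>x\<close>.\<close>
      obtain n where n: "inverse (Suc n) < r / 2"
        using reals_Archimedean[of "r / 2"] r by auto
      obtain z where z: "z \<in> K n" "x \<in> mball z (inverse (Suc n))"
        using K(2)[of n] by blast
      have "mball z (inverse (Suc n)) \<subseteq> mball x r"
      proof
        fix y assume "y \<in> mball z (inverse (Suc n))"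
        then have "d z y < r / 2" "d z x < r / 2"
          using z n by auto
        then have "d x y < r"
          using triangle[of x z y] by (simp add: M commute)
        then show "y \<in> mball x r"
          unfolding in_mball by (simp add: M)
      qed
      with r z show ?thesis
        by (intro bexI[of _ "mball z (inverse (Suc n))"]) (auto simp: B_def)
    qed
  qed
qed

text \<open>Every open set of the square is a union of rectangles with sides in the base
  \<open>B\<close>, and there are only countably many of these. The inclusion reconciles two
  structures: a current is Borel for the product topology, whereas the product of
  \<open>\<nu>\<close> with itself lives on the product sigma-algebra.\<close>

lemma sets_borel_prod_subset:
  assumes "compact (UNIV :: 'x::topological_space set)"
    and "metrizable_space (euclidean :: 'x::topological_space topology)"
  shows "sets (borel :: ('x::topological_space \<times> 'x) measure) \<subseteq> sets (borel \<Otimes>\<^sub>M borel)"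
proof -
  obtain B :: "'x set set" where B: "countable B" "\<And>b. b \<in> B \<Longrightarrow> open b"
    "\<And>x U. open U \<Longrightarrow> x \<in> U \<Longrightarrow> \<exists>b\<in>B. x \<in> b \<and> b \<subseteq> U"
    by (rule compact_metrizable_countable_base[OF assms]) (rule that)
  have "W \<in> sets (borel \<Otimes>\<^sub>M borel)" if "open W" for W :: "('x \<times> 'x) set"
  proof -
    let ?R = "{p \<in> B \<times> B. fst p \<times> snd p \<subseteq> W}"
    have "W = (\<Union>p\<in>?R. fst p \<times> snd p)"
    proof (intro equalityI subsetI)
      fix q assume "q \<in> W"
      obtain S T where ST: "open S" "open T" "q \<in> S \<times> T" "S \<times> T \<subseteq> W"
        by (rule open_prod_elim[OF \<open>open W\<close> \<open>q \<in> W\<close>])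
      obtain a where a: "a \<in> B" "fst q \<in> a" "a \<subseteq> S"
        using B(3)[OF ST(1), of "fst q"] ST(3) by auto
      obtain b where b: "b \<in> B" "snd q \<in> b" "b \<subseteq> T"
        using B(3)[OF ST(2), of "snd q"] ST(3) by auto
      show "q \<in> (\<Union>p\<in>?R. fst p \<times> snd p)"
        using a b ST(4) by (intro UN_I[of "(a, b)"]) (auto simp: mem_Times_iff)
    qed auto
    moreover have "(\<Union>p\<in>?R. fst p \<times> snd p) \<in> sets (borel \<Otimes>\<^sub>M borel)"
      using B(1,2) by (intro sets.countable_UN'') (auto intro!: countable_subset[of ?R "B \<times> B"])
    ultimately show ?thesis
      by simp
  qed
  then have "sigma_sets UNIV (Collect open) \<subseteq> sets (borel \<Otimes>\<^sub>M borel :: ('x \<times> 'x) measure)"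
    using sets.sigma_sets_subset[of "Collect open" "borel \<Otimes>\<^sub>M borel :: ('x \<times> 'x) measure"]
    by (auto simp: space_pair_measure)
  then show ?thesis
    by (simp add: borel_def)
qed

text \<open>A \<open>pmf\<close> has countable support, so its integral is a countable sum of
  weighted terms, and sums of nonnegative functions commute with integration. Measurability is thus
  a question about each \<open>f i\<close> separately.\<close>

lemma nn_integral_measure_pmf_swap:
  fixes f :: "'i \<Rightarrow> 'a \<Rightarrow> ennreal"
  assumes "\<And>i. i \<in> set_pmf p \<Longrightarrow> f i \<in> borel_measurable M"
  shows "(\<integral>\<^sup>+x. \<integral>\<^sup>+i. f i x \<partial>measure_pmf p \<partial>M) = (\<integral>\<^sup>+i. \<integral>\<^sup>+x. f i x \<partial>M \<partial>measure_pmf p)"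
proof -
  have *: "(\<integral>\<^sup>+i. h i \<partial>measure_pmf p) = (\<integral>\<^sup>+i. ennreal (pmf p i) * h i \<partial>count_space (set_pmf p))"
    for h :: "'i \<Rightarrow> ennreal"
    unfolding nn_integral_measure_pmf
    by (auto simp: nn_integral_count_space_indicator set_pmf_iff split: split_indicator
        intro!: nn_integral_cong)
  have "(\<integral>\<^sup>+x. \<integral>\<^sup>+i. f i x \<partial>measure_pmf p \<partial>M)
      = (\<integral>\<^sup>+i. \<integral>\<^sup>+x. ennreal (pmf p i) * f i x \<partial>M \<partial>count_space (set_pmf p))"
    unfolding * by (rule nn_integral_count_space_nn_integral) (use assms in auto)
  also have "\<dots> = (\<integral>\<^sup>+i. ennreal (pmf p i) * (\<integral>\<^sup>+x. f i x \<partial>M) \<partial>count_space (set_pmf p))"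
    using assms by (intro nn_integral_cong nn_integral_cmult) auto
  finally show ?thesis
    by (simp add: *)
qed

text \<open>Splitting \<open>s * t\<close> into powers with exponents
  \<open>1 / 2 + \<epsilon>\<close> and \<open>1 / 2 - \<epsilon>\<close>, the first power combines
  with \<open>r'\<close> into \<open>r\<close>, and the second is a geometric mean. In the
  application \<open>r'\<close> and \<open>r\<close> are values of the current at the translated and
  the original pair, and \<open>s\<close>, \<open>t\<close> are cocycle values.\<close>

lemma powr_interpolation_le:
  fixes r r' s t \<epsilon> :: real
  assumes "r' * (s * t) = r" "s > 0" "t > 0" "r' \<ge> 0"
  shows "r' powr (1 / 2 + \<epsilon>) * (s * t)
    \<le> r powr (1 / 2 + \<epsilon>) * ((s powr (1 - 2 * \<epsilon>) + t powr (1 - 2 * \<epsilon>)) / 2)"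
proof -
  have half: "x powr (1 / 2 - \<epsilon>) = sqrt (x powr (1 - 2 * \<epsilon>))" if "x > 0" for x :: real
    using that by (simp add: powr_half_sqrt[symmetric] powr_powr algebra_simps)
  have "s * t = (s * t) powr (1 / 2 + \<epsilon>) * (s * t) powr (1 / 2 - \<epsilon>)"
    using assms by (simp flip: powr_add)
  then have "r' powr (1 / 2 + \<epsilon>) * (s * t)
      = (r' powr (1 / 2 + \<epsilon>) * (s * t) powr (1 / 2 + \<epsilon>)) * (s * t) powr (1 / 2 - \<epsilon>)"
    by simp
  also have "\<dots> = r powr (1 / 2 + \<epsilon>) * (s * t) powr (1 / 2 - \<epsilon>)"
    using assms by (simp flip: powr_mult)
  also have "(s * t) powr (1 / 2 - \<epsilon>) = sqrt (s powr (1 - 2 * \<epsilon>) * t powr (1 - 2 * \<epsilon>))"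
    using assms by (simp add: powr_mult half real_sqrt_mult)
  also have "\<dots> \<le> (s powr (1 - 2 * \<epsilon>) + t powr (1 - 2 * \<epsilon>)) / 2"
    by (rule arith_geo_mean_sqrt) auto
  finally show ?thesis
    by (simp add: mult_left_mono)
qed

section \<open>The Radon-Nikodym cocycle and change of variables\<close>

context compact_measured_group_space
begin

declare sets_borel [measurable_cong]

lemma space_nu [simp]: "space \<nu> = UNIV"
  using sets_eq_imp_space_eq[OF sets_borel] by simp

lemma measurable_act: "g \<in> carrier G \<Longrightarrow> act g \<in> borel \<rightarrow>\<^sub>M borel"
  using act_homeomorphism[of g] by (intro borel_measurable_continuous_onI) (auto simp: homeomorphism_def)

lemma act_inv_act [simp]: "g \<in> carrier G \<Longrightarrow> act (inv g) (act g x) = x"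
  and act_act_inv [simp]: "g \<in> carrier G \<Longrightarrow> act g (act (inv g) x) = x"
  using act_homeomorphism[of g] by (auto simp: homeomorphism_def)

lemma measurable_rn_cocycle [measurable]: "rn_cocycle G act \<nu> g \<in> borel_measurable \<nu>"
  unfolding rn_cocycle_def by simp

lemma rn_cocycle_nonneg [simp]: "0 \<le> rn_cocycle G act \<nu> g x"
  by (simp add: rn_cocycle_def)

lemma
  assumes g: "g \<in> carrier G"
  shows density_rn_cocycle: "density \<nu> (\<lambda>x. ennreal (rn_cocycle G act \<nu> g x)) = distr \<nu> borel (act (inv g))"
    and AE_rn_cocycle_pos: "AE x in \<nu>. 0 < rn_cocycle G act \<nu> g x"
proof -
  let ?N = "distr \<nu> borel (act (inv g))"
  have act: "act (inv g) \<in> \<nu> \<rightarrow>\<^sub>M borel"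
    using measurable_act[of "inv g"] g by (simp add: measurable_cong_sets[OF sets_borel refl])
  interpret N: prob_space ?N
    by (rule prob_space_distr[OF act])
  have null: "null_sets ?N = null_sets \<nu>"
    using measure_class_preserved[of "inv g"] g by simp
  have ac: "absolutely_continuous \<nu> ?N"
    by (simp add: absolutely_continuous_def null)
  have eq: "density \<nu> (RN_deriv \<nu> ?N) = ?N"
    by (rule density_RN_deriv[OF ac]) (simp add: sets_borel)
  \<comment> \<open>The push-forward is a probability measure, hence sigma-finite, so
    \<open>enn2real\<close> changes the derivative on a null set only.\<close>
  have fin: "AE x in \<nu>. RN_deriv \<nu> ?N x \<noteq> \<infinity>"
    by (rule RN_deriv_finite[OF _ ac]) (simp_all add: sets_borel N.sigma_finite_measure_axioms)
  have "AE x in \<nu>. RN_deriv \<nu> ?N x = ennreal (rn_cocycle G act \<nu> g x)"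
    using fin by eventually_elim (simp add: rn_cocycle_def less_top)
  then show *: "density \<nu> (\<lambda>x. ennreal (rn_cocycle G act \<nu> g x)) = ?N"
    by (subst eq[symmetric], intro density_cong) auto
  \<comment> \<open>A density is positive almost everywhere for the measure that it defines;
    equality of null sets carries this over to \<open>\<nu>\<close>.\<close>
  have "AE x in ?N. 0 < rn_cocycle G act \<nu> g x"
    unfolding *[symmetric] by (subst AE_density) auto
  moreover have "space ?N = space \<nu>"
    by simp
  ultimately show "AE x in \<nu>. 0 < rn_cocycle G act \<nu> g x"
    unfolding eventually_ae_filter null by simp
qed

lemma nn_integral_act_inv:
  assumes g: "g \<in> carrier G" and [measurable]: "f \<in> borel_measurable \<nu>"
  shows "(\<integral>\<^sup>+x. f (act (inv g) x) \<partial>\<nu>) = (\<integral>\<^sup>+x. f x * ennreal (rn_cocycle G act \<nu> g x) \<partial>\<nu>)"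
proof -
  have [measurable]: "act (inv g) \<in> \<nu> \<rightarrow>\<^sub>M borel" "f \<in> borel_measurable borel"
    using measurable_act[of "inv g"] g assms(2)
    by (simp_all add: measurable_cong_sets[OF sets_borel refl])
  have "(\<integral>\<^sup>+x. f (act (inv g) x) \<partial>\<nu>) = (\<integral>\<^sup>+x. f x \<partial>distr \<nu> borel (act (inv g)))"
    by (subst nn_integral_distr) auto
  also have "\<dots> = (\<integral>\<^sup>+x. f x * ennreal (rn_cocycle G act \<nu> g x) \<partial>\<nu>)"
    by (subst density_rn_cocycle[OF g, symmetric], subst nn_integral_density) (auto simp: mult.commute)
  finally show ?thesis .
qed

section \<open>The off-diagonal part of the square\<close>

text \<open>The space is Hausdorff, so the complement of the diagonal is open, and open sets of the
  square belong to the product sigma-algebra.\<close>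

lemma offdiag_in_sets: "offdiag \<in> sets (\<nu> \<Otimes>\<^sub>M \<nu>)"
proof -
  have "Hausdorff_space (euclidean :: 'x topology)"
    by (rule metrizable_imp_Hausdorff_space[OF metrizable])
  then have H: "\<exists>U V. open U \<and> open V \<and> x \<in> U \<and> y \<in> V \<and> U \<inter> V = {}" if "x \<noteq> y" for x y :: 'x
    using that by (simp add: Hausdorff_space_def disjnt_def)
  have "open (offdiag :: ('x \<times> 'x) set)"
  proof (rule open_prod_intro)
    fix p :: "'x \<times> 'x" assume "p \<in> offdiag"
    then obtain U V where "open U" "open V" "fst p \<in> U" "snd p \<in> V" "U \<inter> V = {}"
      using H[of "fst p" "snd p"] by (auto simp: offdiag_def)
    then show "\<exists>A B. open A \<and> open B \<and> p \<in> A \<times> B \<and> A \<times> B \<subseteq> offdiag"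
      by (intro exI[of _ U] exI[of _ V]) (auto simp: offdiag_def mem_Times_iff)
  qed
  then have "offdiag \<in> sets (borel \<Otimes>\<^sub>M borel :: ('x \<times> 'x) measure)"
    using sets_borel_prod_subset[OF compact_UNIV metrizable] by auto
  then show ?thesis
    by (simp add: sets_pair_measure_cong[OF sets_borel sets_borel])
qed

lemma measurable_offdiag_extension:
  assumes "\<rho> \<in> borel_measurable (restrict_space borel offdiag)"
  shows "(\<lambda>p. \<rho> p * indicator offdiag p :: real) \<in> borel_measurable (\<nu> \<Otimes>\<^sub>M \<nu>)"
proof -
  have "sets (restrict_space borel offdiag) \<subseteq> sets (restrict_space (\<nu> \<Otimes>\<^sub>M \<nu>) offdiag)"
    using sets_borel_prod_subset[OF compact_UNIV metrizable]
    unfolding sets_restrict_space sets_pair_measure_cong[OF sets_borel sets_borel]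
    by (rule image_mono)
  then have "\<rho> \<in> borel_measurable (restrict_space (\<nu> \<Otimes>\<^sub>M \<nu>) offdiag)"
    using assms by (auto simp: measurable_def space_restrict_space space_pair_measure)
  then show ?thesis
    by (subst (asm) borel_measurable_restrict_space_iff)
      (auto simp: offdiag_in_sets space_pair_measure mult.commute)
qed

lemma nn_integral_offdiag_measure:
  "(\<integral>\<^sup>+p. f p \<partial>offdiag_measure \<nu>) = (\<integral>\<^sup>+p. f p * indicator offdiag p \<partial>(\<nu> \<Otimes>\<^sub>M \<nu>))"
  unfolding offdiag_measure_def
  by (rule nn_integral_restrict_space) (simp add: offdiag_in_sets space_pair_measure)

lemma measurable_diagonal_act:
  assumes "g \<in> carrier G"
  shows "(\<lambda>(x, y). (act g x, act g y)) \<in> \<nu> \<Otimes>\<^sub>M \<nu> \<rightarrow>\<^sub>M \<nu> \<Otimes>\<^sub>M \<nu>"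
proof -
  have [measurable]: "act g \<in> \<nu> \<rightarrow>\<^sub>M \<nu>"
    using measurable_act[OF assms] by (simp add: measurable_cong_sets[OF sets_borel sets_borel])
  show ?thesis
    by measurable
qed

text \<open>By Tonelli the one-variable substitution applies to each coordinate in turn, and the two
  densities multiply.\<close>

lemma nn_integral_diagonal_act_inv:
  assumes g: "g \<in> carrier G" and f [measurable]: "f \<in> borel_measurable (\<nu> \<Otimes>\<^sub>M \<nu>)"
  shows "(\<integral>\<^sup>+p. f (act (inv g) (fst p), act (inv g) (snd p)) \<partial>(\<nu> \<Otimes>\<^sub>M \<nu>))
    = (\<integral>\<^sup>+p. f p * ennreal (rn_cocycle G act \<nu> g (fst p) * rn_cocycle G act \<nu> g (snd p)) \<partial>(\<nu> \<Otimes>\<^sub>M \<nu>))"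
proof -
  let ?s = "rn_cocycle G act \<nu> g"
  have [measurable]: "act (inv g) \<in> \<nu> \<rightarrow>\<^sub>M \<nu>"
    using measurable_act[of "inv g"] g by (simp add: measurable_cong_sets[OF sets_borel sets_borel])
  have "(\<integral>\<^sup>+p. f (act (inv g) (fst p), act (inv g) (snd p)) \<partial>(\<nu> \<Otimes>\<^sub>M \<nu>))
      = (\<integral>\<^sup>+x. \<integral>\<^sup>+y. f (act (inv g) x, act (inv g) y) \<partial>\<nu> \<partial>\<nu>)"
    by (subst nn_integral_fst[symmetric]) auto
  also have "\<dots> = (\<integral>\<^sup>+x. \<integral>\<^sup>+y. f (act (inv g) x, y) * ennreal (?s y) \<partial>\<nu> \<partial>\<nu>)"
    by (intro nn_integral_cong nn_integral_act_inv[OF g]) auto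
  also have "\<dots> = (\<integral>\<^sup>+x. (\<integral>\<^sup>+y. f (x, y) * ennreal (?s y) \<partial>\<nu>) * ennreal (?s x) \<partial>\<nu>)"
    by (rule nn_integral_act_inv[OF g, where f = "\<lambda>x. \<integral>\<^sup>+y. f (x, y) * ennreal (?s y) \<partial>\<nu>"]) measurable
  also have "\<dots> = (\<integral>\<^sup>+x. \<integral>\<^sup>+y. f (x, y) * ennreal (?s x * ?s y) \<partial>\<nu> \<partial>\<nu>)"
    by (intro nn_integral_cong, subst nn_integral_multc[symmetric])
      (auto simp: ennreal_mult mult_ac intro!: nn_integral_cong)
  also have "\<dots> = (\<integral>\<^sup>+p. f p * ennreal (?s (fst p) * ?s (snd p)) \<partial>(\<nu> \<Otimes>\<^sub>M \<nu>))"
    by (subst nn_integral_fst[symmetric]) auto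
  finally show ?thesis .
qed

section \<open>Almost-everywhere statements on the square and the cocycle identity of the
  current\<close>

lemma AE_pair_fst_snd:
  assumes "AE x in \<nu>. Q x"
  shows "AE p in \<nu> \<Otimes>\<^sub>M \<nu>. Q (fst p) \<and> Q (snd p)"
proof -
  obtain N where N: "N \<in> null_sets \<nu>" "{x \<in> space \<nu>. \<not> Q x} \<subseteq> N"
    using assms unfolding eventually_ae_filter by blast
  then have "N \<times> UNIV \<in> null_sets (\<nu> \<Otimes>\<^sub>M \<nu>)" "UNIV \<times> N \<in> null_sets (\<nu> \<Otimes>\<^sub>M \<nu>)"
    using sets.top[of \<nu>] by (auto simp: null_sets_def emeasure_pair_measure_Times)
  then have "N \<times> UNIV \<union> UNIV \<times> N \<in> null_sets (\<nu> \<Otimes>\<^sub>M \<nu>)"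
    by (rule null_sets.Un)
  then show ?thesis
    by (rule AE_I') (use N in auto)
qed

text \<open>Extending \<open>\<rho>\<close> by zero to the diagonal allows all computations to take place on \<open>\<nu> \<Otimes>\<^sub>M \<nu>\<close>.\<close>

lemma product_current_cocycle:
  assumes \<rho>: "product_current G act \<nu> \<rho>" and g: "g \<in> carrier G"
  defines "R \<equiv> \<lambda>p. \<rho> p * indicator offdiag p"
  shows "AE p in \<nu> \<Otimes>\<^sub>M \<nu>. R (act g (fst p), act g (snd p))
      * (rn_cocycle G act \<nu> g (fst p) * rn_cocycle G act \<nu> g (snd p)) = R p"
proof -
  let ?P = "\<nu> \<Otimes>\<^sub>M \<nu>" and ?m = "offdiag_measure \<nu>"
  let ?S = "\<lambda>p. rn_cocycle G act \<nu> g (fst p) * rn_cocycle G act \<nu> g (snd p)"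
  let ?T = "\<lambda>p. (act g (fst p), act g (snd p))"
  let ?T' = "\<lambda>p. (act (inv g) (fst p), act (inv g) (snd p))"
  interpret P: pair_prob_space \<nu> \<nu> ..
  have R [measurable]: "R \<in> borel_measurable ?P"
    using measurable_offdiag_extension \<rho> unfolding R_def product_current_def by blast
  have R0: "0 \<le> R p" for p
    using \<rho> by (auto simp: R_def product_current_def split: split_indicator)
  have T [measurable]: "?T \<in> ?P \<rightarrow>\<^sub>M ?P" and T' [measurable]: "?T' \<in> ?P \<rightarrow>\<^sub>M ?P"
    using measurable_diagonal_act[OF g] measurable_diagonal_act[of "inv g"] g
    by (simp_all add: case_prod_beta')
  have inj: "act h x = act h y \<longleftrightarrow> x = y" if "h \<in> carrier G" for h x y
    using that by (metis act_inv_act)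
  have T'm: "?T' \<in> ?m \<rightarrow>\<^sub>M ?m"
    unfolding offdiag_measure_def
    by (rule measurable_restrict_space3[OF T']) (use g in \<open>auto simp: offdiag_def inj\<close>)
  have \<rho>m: "\<rho> \<in> borel_measurable ?m"
    using R unfolding offdiag_measure_def R_def
    by (subst borel_measurable_restrict_space_iff)
      (auto simp: offdiag_in_sets space_pair_measure mult.commute)
  \<comment> \<open>Invariance is used for \<open>inv g\<close>, because the change of variables is
    stated for \<open>act (inv g)\<close>.\<close>
  have inv: "distr (density ?m (\<lambda>p. ennreal (\<rho> p))) ?m ?T' = density ?m (\<lambda>p. ennreal (\<rho> p))"
    using \<rho> g by (auto simp: product_current_def case_prod_beta')
  \<comment> \<open>The pointwise identity is reached through measures: both sides are densities of
    the same measure. Uniqueness of densities needs sigma-finiteness of the base measure only, so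
    the current itself may have infinite mass.\<close>
  have dens: "density ?P (\<lambda>p. ennreal (R p)) = density ?P (\<lambda>p. ennreal (R (?T p) * ?S p))"
  proof (rule measure_eqI)
    fix A assume "A \<in> sets (density ?P (\<lambda>p. ennreal (R p)))"
    then have A [measurable]: "A \<in> sets ?P"
      by simp
    have Am: "A \<inter> offdiag \<in> sets ?m"
      using A by (auto simp: offdiag_measure_def sets_restrict_space)
    then have ind [measurable]: "indicator (A \<inter> offdiag) \<in> borel_measurable ?m"
      by simp
    have *: "(\<integral>\<^sup>+p. ennreal (\<rho> p) * f p \<partial>?m) = (\<integral>\<^sup>+p. ennreal (R p) * f p \<partial>?P)" for f
      unfolding nn_integral_offdiag_measure
      by (intro nn_integral_cong) (auto simp: R_def split: split_indicator)
    \<comment> \<open>Since \<open>R\<close> vanishes on the diagonal, cutting \<open>A\<close> down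
      to \<open>offdiag\<close> is harmless; this allows passing between \<open>?P\<close> and
      \<open>?m\<close>.\<close>
    have R_ind: "ennreal (R p) * indicator (A \<inter> offdiag) q = ennreal (R p) * indicator A q"
      if "p \<in> offdiag \<Longrightarrow> q \<in> offdiag" for p q
      using that by (auto simp: R_def split: split_indicator)
    have "emeasure (density ?P (\<lambda>p. ennreal (R p))) A
        = (\<integral>\<^sup>+p. ennreal (R p) * indicator (A \<inter> offdiag) p \<partial>?P)"
      using R_ind by (simp add: emeasure_density)
    also have "\<dots> = (\<integral>\<^sup>+p. indicator (A \<inter> offdiag) p \<partial>density ?m (\<lambda>p. ennreal (\<rho> p)))"
      using \<rho>m by (subst nn_integral_density) (auto simp: *)
    also have "\<dots> = (\<integral>\<^sup>+p. indicator (A \<inter> offdiag) (?T' p) \<partial>density ?m (\<lambda>p. ennreal (\<rho> p)))"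
      by (subst inv[symmetric], subst nn_integral_distr) (use T'm ind in auto)
    also have "\<dots> = (\<integral>\<^sup>+p. ennreal (R p) * indicator (A \<inter> offdiag) (?T' p) \<partial>?P)"
      using \<rho>m measurable_compose[OF T'm ind] by (subst nn_integral_density) (auto simp: *)
    \<comment> \<open>Writing \<open>p\<close> as \<open>?T (?T' p)\<close> makes the integrand a
      function of \<open>?T' p\<close>, ready for the substitution.\<close>
    also have "\<dots> = (\<integral>\<^sup>+p. ennreal (R (?T (?T' p))) * indicator A (?T' p) \<partial>?P)"
      using g by (intro nn_integral_cong, subst R_ind) (auto simp: offdiag_def inj)
    also have "\<dots> = (\<integral>\<^sup>+p. ennreal (R (?T p)) * indicator A p * ennreal (?S p) \<partial>?P)"
      by (rule nn_integral_diagonal_act_inv[OF g, where f = "\<lambda>p. ennreal (R (?T p)) * indicator A p"])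
        measurable
    also have "\<dots> = emeasure (density ?P (\<lambda>p. ennreal (R (?T p) * ?S p))) A"
      by (subst emeasure_density) (auto simp: ennreal_mult R0 mult_ac intro!: nn_integral_cong)
    finally show "emeasure (density ?P (\<lambda>p. ennreal (R p))) A
        = emeasure (density ?P (\<lambda>p. ennreal (R (?T p) * ?S p))) A" .
  qed simp
  have "AE p in ?P. ennreal (R p) = ennreal (R (?T p) * ?S p)"
    by (rule P.density_unique[OF _ _ dens]) measurable
  then show ?thesis
    by eventually_elim (simp add: R0)
qed

section \<open>Iterates of the convolution operator\<close>

lemma set_conv_power: "set_pmf (conv_power G \<mu> n) \<subseteq> carrier G"
  using supp_subset by (induction n) (auto simp: convolution_def)

text \<open>The function \<open>u\<close> is only essentially bounded, so the Bochner integrals defining \<open>Q\<^sup>n u\<close> may have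
  the junk value \<open>0\<close>; boundedness along the orbits of \<open>x\<close> and \<open>y\<close> excludes this.\<close>

lemma norm_conv_operator_power_diff_le:
  fixes u :: "'x \<Rightarrow> 'k::{real_normed_field, banach, second_countable_topology}"
  assumes "\<And>g. g \<in> carrier G \<Longrightarrow> norm (u (act g x)) \<le> C"
    and "\<And>g. g \<in> carrier G \<Longrightarrow> norm (u (act g y)) \<le> C"
  defines "Q \<equiv> conv_operator G act \<mu>"
  shows "ennreal (norm ((Q ^^ n) u x - (Q ^^ n) u y))
    \<le> (\<integral>\<^sup>+g. ennreal (norm (u (act (inv g) x) - u (act (inv g) y))) \<partial>measure_pmf (conv_power G \<mu> n))"
proof -
  have Q_Suc: "(Q ^^ Suc n) u z = (\<integral>g. (Q ^^ n) u (act (inv g) z) \<partial>measure_pmf \<mu>)" for n z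
    by (simp add: Q_def conv_operator_def)
  have tr: "norm (u (act h (act (inv g) z))) \<le> C"
    if "g \<in> carrier G" "h \<in> carrier G" "\<And>g. g \<in> carrier G \<Longrightarrow> norm (u (act g z)) \<le> C" for g h z
    using that(3)[of "h \<otimes> inv g"] that(1,2) by (simp add: composition_rule)
  \<comment> \<open>Averaging preserves the orbit bound, so at each stage the integrand is bounded
    and hence integrable for a probability measure.\<close>
  have bound: "norm ((Q ^^ n) u z) \<le> C" if "\<And>g. g \<in> carrier G \<Longrightarrow> norm (u (act g z)) \<le> C" for n z
    using that
  proof (induction n arbitrary: z)
    case 0
    show ?case
      using 0[of \<one>] id_eq_one by (auto simp: restrict_def fun_eq_iff)
  next
    case (Suc n)
    have *: "norm ((Q ^^ n) u (act (inv g) z)) \<le> C" if "g \<in> set_pmf \<mu>" for g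
      using that supp_subset Suc.prems by (auto intro!: Suc.IH tr)
    have "integrable (measure_pmf \<mu>) (\<lambda>g. (Q ^^ n) u (act (inv g) z))"
      using * by (intro measure_pmf.integrable_const_bound[of _ C]) (auto simp: AE_measure_pmf_iff)
    then have "(\<integral>g. norm ((Q ^^ n) u (act (inv g) z)) \<partial>measure_pmf \<mu>) \<le> C"
      using * by (intro measure_pmf.integral_le_const) (auto simp: AE_measure_pmf_iff)
    then have "norm (\<integral>g. (Q ^^ n) u (act (inv g) z) \<partial>measure_pmf \<mu>) \<le> C"
      by (rule order_trans[OF integral_norm_bound])
    then show ?case
      unfolding Q_Suc .
  qed
  show ?thesis
    using assms(1,2)
  proof (induction n arbitrary: x y)
    case 0
    have "act \<one> z = z" for z
      using id_eq_one by (auto simp: restrict_def fun_eq_iff)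
    then show ?case
      by simp
  next
    case (Suc n)
    let ?v = "(Q ^^ n) u"
    have int: "integrable (measure_pmf \<mu>) (\<lambda>g. ?v (act (inv g) z))"
      if "\<And>g. g \<in> carrier G \<Longrightarrow> norm (u (act g z)) \<le> C" for z
      using supp_subset tr that
      by (intro measure_pmf.integrable_const_bound[of _ C]) (auto simp: AE_measure_pmf_iff intro!: bound)
    \<comment> \<open>Linearity of the Bochner integral requires both integrands to be integrable,
      which \<open>int\<close> supplies.\<close>
    have diff: "(Q ^^ Suc n) u x - (Q ^^ Suc n) u y
        = (\<integral>g. ?v (act (inv g) x) - ?v (act (inv g) y) \<partial>measure_pmf \<mu>)"
      using int[of x] int[of y] Suc.prems unfolding Q_Suc by simp
    have "ennreal (norm ((Q ^^ Suc n) u x - (Q ^^ Suc n) u y))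
        \<le> (\<integral>\<^sup>+g. ennreal (norm (?v (act (inv g) x) - ?v (act (inv g) y))) \<partial>measure_pmf \<mu>)"
      unfolding diff using int[of x] int[of y] Suc.prems
      by (intro integral_norm_bound_ennreal Bochner_Integration.integrable_diff) auto
    also have "\<dots> \<le> (\<integral>\<^sup>+g. \<integral>\<^sup>+h. ennreal (norm (u (act (inv h) (act (inv g) x)) - u (act (inv h) (act (inv g) y))))
        \<partial>measure_pmf (conv_power G \<mu> n) \<partial>measure_pmf \<mu>)"
      using supp_subset Suc.prems
      by (intro nn_integral_mono_AE) (auto simp: AE_measure_pmf_iff intro!: Suc.IH tr)
    \<comment> \<open>Inversion reverses products, so acting by \<open>inv g\<close> and then by
      \<open>inv h\<close> is acting by \<open>inv (g \<otimes> h)\<close>. This matches the order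
      of the factors in \<open>conv_power\<close>.\<close>
    also have "\<dots> = (\<integral>\<^sup>+g. \<integral>\<^sup>+h. ennreal (norm (u (act (inv (g \<otimes> h)) x) - u (act (inv (g \<otimes> h)) y)))
        \<partial>measure_pmf (conv_power G \<mu> n) \<partial>measure_pmf \<mu>)"
      using supp_subset set_conv_power[of n]
      by (intro nn_integral_cong_AE)
        (auto simp: AE_measure_pmf_iff inv_mult_group composition_rule subset_iff intro!: nn_integral_cong_AE)
    also have "\<dots> = (\<integral>\<^sup>+g. ennreal (norm (u (act (inv g) x) - u (act (inv g) y)))
        \<partial>measure_pmf (conv_power G \<mu> (Suc n)))"
      by (simp add: convolution_def)
    finally show ?case .
  qed
qed

text \<open>Translates of the exceptional null set are null because the action preserves the measure
  class, and a countable group produces only countably many of them.\<close>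

lemma L_infinity_AE_orbit_bounded:
  assumes "u \<in> L_infinity \<nu>"
  obtains C where "AE x in \<nu>. \<forall>g\<in>carrier G. norm (u (act g x)) \<le> C"
proof -
  obtain C where C: "AE x in \<nu>. norm (u x) \<le> C"
    using assms by (auto simp: L_infinity_def)
  have "AE x in \<nu>. norm (u (act g x)) \<le> C" if g: "g \<in> carrier G" for g
  proof -
    have "AE x in distr \<nu> borel (act g). norm (u x) \<le> C"
      using C unfolding eventually_ae_filter measure_class_preserved[OF g] by simp
    then show ?thesis
      using measurable_act[OF g] by (intro AE_distrD[of "act g" \<nu> borel])
        (simp_all add: measurable_cong_sets[OF sets_borel refl])
  qed
  then have "AE x in \<nu>. \<forall>g\<in>carrier G. norm (u (act g x)) \<le> C"
    by (simp add: AE_ball_countable countable_carrier)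
  then show thesis
    by (rule that)
qed

section \<open>The seminorm estimate\<close>

lemma N_seminorm_conv_operator_power_le:
  fixes u :: "'x \<Rightarrow> 'k::{real_normed_field, banach, second_countable_topology}"
  assumes \<rho>: "product_current G act \<nu> \<rho>" and u: "u \<in> L_infinity \<nu>"
  shows "N_seminorm \<nu> \<rho> \<epsilon> ((conv_operator G act \<mu> ^^ n) u)
    \<le> tau G \<mu> act \<nu> \<epsilon> n * N_seminorm \<nu> \<rho> \<epsilon> u"
proof -
  let ?P = "\<nu> \<Otimes>\<^sub>M \<nu>" and ?\<mu>n = "measure_pmf (conv_power G \<mu> n)"
  let ?v = "(conv_operator G act \<mu> ^^ n) u"
  define \<sigma> where "\<sigma> = rn_cocycle G act \<nu>"
  define R where "R p = \<rho> p * indicator offdiag p" for p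
  define D where "D w p = norm (w (fst p) - w (snd p))" for w :: "'x \<Rightarrow> 'k" and p
  define S where "S g x = ennreal (\<sigma> g x powr (1 - 2 * \<epsilon>))" for g x
  define F where "F x = (\<integral>\<^sup>+g. S g x \<partial>?\<mu>n)" for x
  have R [measurable]: "R \<in> borel_measurable ?P"
    using measurable_offdiag_extension \<rho> unfolding R_def product_current_def by blast
  have R0: "0 \<le> R p" for p
    using \<rho> by (auto simp: R_def product_current_def split: split_indicator)
  have [measurable]: "u \<in> borel_measurable \<nu>"
    using u by (simp add: L_infinity_def)
  have \<sigma>_meas [measurable]: "\<sigma> g \<in> borel_measurable \<nu>" for g
    by (simp add: \<sigma>_def)
  have S_meas [measurable]: "S g \<in> borel_measurable \<nu>" for g
    unfolding S_def by measurable
  have D_meas [measurable]: "D u \<in> borel_measurable ?P"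
    unfolding D_def by measurable
  \<comment> \<open>On the diagonal \<open>R\<close> is \<open>0\<close>, and
    \<open>0 powr a\<close> is \<open>0\<close> for every \<open>a\<close>, so the integral over the
    whole square adds nothing.\<close>
  have N: "N_seminorm \<nu> \<rho> \<epsilon> w = (\<integral>\<^sup>+p. ennreal (D w p * R p powr (1 / 2 + \<epsilon>)) \<partial>?P)" for w :: "'x \<Rightarrow> 'k"
    unfolding N_seminorm_def nn_integral_offdiag_measure
    by (intro nn_integral_cong) (auto simp: D_def R_def split: split_indicator)
  obtain C where C: "AE x in \<nu>. \<forall>g\<in>carrier G. norm (u (act g x)) \<le> C"
    using L_infinity_AE_orbit_bounded[OF u] .
  define T where "T g p = (act (inv g) (fst p), act (inv g) (snd p))" for g and p :: "'x \<times> 'x"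
  have T_meas [measurable]: "T g \<in> ?P \<rightarrow>\<^sub>M ?P" if "g \<in> carrier G" for g
    using measurable_diagonal_act[of "inv g"] that by (simp add: T_def[abs_def] case_prod_beta')
  have "N_seminorm \<nu> \<rho> \<epsilon> ?v = (\<integral>\<^sup>+p. ennreal (D ?v p * R p powr (1 / 2 + \<epsilon>)) \<partial>?P)"
    by (rule N)
  also have "\<dots> \<le> (\<integral>\<^sup>+p. \<integral>\<^sup>+g. ennreal (D u (T g p) * R p powr (1 / 2 + \<epsilon>)) \<partial>?\<mu>n \<partial>?P)"
  proof (rule nn_integral_mono_AE)
    show "AE p in ?P. ennreal (D ?v p * R p powr (1 / 2 + \<epsilon>))
        \<le> (\<integral>\<^sup>+g. ennreal (D u (T g p) * R p powr (1 / 2 + \<epsilon>)) \<partial>?\<mu>n)"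
      using AE_pair_fst_snd[OF C]
    proof eventually_elim
      case (elim p)
      then have "ennreal (D ?v p) \<le> (\<integral>\<^sup>+g. ennreal (D u (T g p)) \<partial>?\<mu>n)"
        unfolding D_def T_def fst_conv snd_conv
        by (intro norm_conv_operator_power_diff_le[of _ _ C]) auto
      then have "ennreal (D ?v p) * ennreal (R p powr (1 / 2 + \<epsilon>))
          \<le> (\<integral>\<^sup>+g. ennreal (D u (T g p)) \<partial>?\<mu>n) * ennreal (R p powr (1 / 2 + \<epsilon>))"
        by (rule mult_right_mono) simp
      also have "\<dots> = (\<integral>\<^sup>+g. ennreal (D u (T g p)) * ennreal (R p powr (1 / 2 + \<epsilon>)) \<partial>?\<mu>n)"
        by (simp add: nn_integral_multc)
      finally show ?case
        by (simp add: ennreal_mult D_def)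
    qed
  qed
  also have "\<dots> = (\<integral>\<^sup>+g. \<integral>\<^sup>+p. ennreal (D u (T g p) * R p powr (1 / 2 + \<epsilon>)) \<partial>?P \<partial>?\<mu>n)"
  proof (rule nn_integral_measure_pmf_swap)
    fix g assume "g \<in> set_pmf (conv_power G \<mu> n)"
    then have [simp]: "g \<in> carrier G"
      using set_conv_power by auto
    show "(\<lambda>p. ennreal (D u (T g p) * R p powr (1 / 2 + \<epsilon>))) \<in> borel_measurable ?P"
      by measurable
  qed
  also have "\<dots> \<le> (\<integral>\<^sup>+g. \<integral>\<^sup>+p. ennreal (D u p * R p powr (1 / 2 + \<epsilon>))
      * ((S g (fst p) + S g (snd p)) / 2) \<partial>?P \<partial>?\<mu>n)"
  proof (rule nn_integral_mono_AE, unfold AE_measure_pmf_iff, rule ballI)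
    fix g assume "g \<in> set_pmf (conv_power G \<mu> n)"
    then have g [simp]: "g \<in> carrier G"
      using set_conv_power by auto
    let ?A = "\<lambda>p. (act g (fst p), act g (snd p))"
    have A_meas [measurable]: "?A \<in> ?P \<rightarrow>\<^sub>M ?P"
      using measurable_diagonal_act[OF g] by (simp add: case_prod_beta')
    \<comment> \<open>Again \<open>p\<close> is written as \<open>?A (T g p)\<close>, so that the
      integrand depends on \<open>T g p\<close> alone.\<close>
    have "(\<integral>\<^sup>+p. ennreal (D u (T g p) * R p powr (1 / 2 + \<epsilon>)) \<partial>?P)
        = (\<integral>\<^sup>+p. ennreal (D u (T g p) * R (?A (T g p)) powr (1 / 2 + \<epsilon>)) \<partial>?P)"
      by (simp add: T_def)
    also have "\<dots> = (\<integral>\<^sup>+p. ennreal (D u p * R (?A p) powr (1 / 2 + \<epsilon>))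
        * ennreal (\<sigma> g (fst p) * \<sigma> g (snd p)) \<partial>?P)"
      unfolding T_def \<sigma>_def
      by (rule nn_integral_diagonal_act_inv[OF g,
            where f = "\<lambda>p. ennreal (D u p * R (?A p) powr (1 / 2 + \<epsilon>))"]) measurable
    also have "\<dots> \<le> (\<integral>\<^sup>+p. ennreal (D u p * R p powr (1 / 2 + \<epsilon>))
        * ((S g (fst p) + S g (snd p)) / 2) \<partial>?P)"
    proof (rule nn_integral_mono_AE)
      show "AE p in ?P. ennreal (D u p * R (?A p) powr (1 / 2 + \<epsilon>)) * ennreal (\<sigma> g (fst p) * \<sigma> g (snd p))
          \<le> ennreal (D u p * R p powr (1 / 2 + \<epsilon>)) * ((S g (fst p) + S g (snd p)) / 2)"
        \<comment> \<open>Besides the cocycle identity, the interpolation inequality needs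
          \<open>\<sigma> g\<close> to be positive at both coordinates.\<close>
        using product_current_cocycle[OF \<rho> g] AE_pair_fst_snd[OF AE_rn_cocycle_pos[OF g]]
      proof eventually_elim
        case (elim p)
        let ?s = "\<sigma> g (fst p)" and ?t = "\<sigma> g (snd p)"
        have "R (?A p) powr (1 / 2 + \<epsilon>) * (?s * ?t)
            \<le> R p powr (1 / 2 + \<epsilon>) * ((?s powr (1 - 2 * \<epsilon>) + ?t powr (1 - 2 * \<epsilon>)) / 2)"
          using elim by (intro powr_interpolation_le) (auto simp: \<sigma>_def R0, auto simp: R_def)
        then have "D u p * (R (?A p) powr (1 / 2 + \<epsilon>) * (?s * ?t))
            \<le> D u p * (R p powr (1 / 2 + \<epsilon>) * ((?s powr (1 - 2 * \<epsilon>) + ?t powr (1 - 2 * \<epsilon>)) / 2))"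
          by (rule mult_left_mono) (simp add: D_def)
        then have "ennreal (D u p * R (?A p) powr (1 / 2 + \<epsilon>) * (?s * ?t))
            \<le> ennreal (D u p * R p powr (1 / 2 + \<epsilon>) * ((?s powr (1 - 2 * \<epsilon>) + ?t powr (1 - 2 * \<epsilon>)) / 2))"
          by (intro ennreal_leI) (simp only: mult.assoc)
        moreover have "(S g (fst p) + S g (snd p)) / 2
            = ennreal ((?s powr (1 - 2 * \<epsilon>) + ?t powr (1 - 2 * \<epsilon>)) / 2)"
          by (simp add: S_def divide_ennreal[symmetric] ennreal_plus[symmetric] del: ennreal_plus)
        ultimately show ?case
          by (simp add: ennreal_mult[symmetric] D_def \<sigma>_def)
      qed
    qed
    finally show "(\<integral>\<^sup>+p. ennreal (D u (T g p) * R p powr (1 / 2 + \<epsilon>)) \<partial>?P) \<le> \<dots>" .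
  qed
  also have "\<dots> = (\<integral>\<^sup>+p. \<integral>\<^sup>+g. ennreal (D u p * R p powr (1 / 2 + \<epsilon>))
      * ((S g (fst p) + S g (snd p)) / 2) \<partial>?\<mu>n \<partial>?P)"
    by (rule nn_integral_measure_pmf_swap[symmetric]) measurable
  \<comment> \<open>The weight does not depend on \<open>g\<close>, so only the cocycle powers are
    averaged; \<open>F\<close> is the function whose essential supremum is
    \<open>tau\<close>.\<close>
  also have "\<dots> = (\<integral>\<^sup>+p. ennreal (D u p * R p powr (1 / 2 + \<epsilon>)) * ((F (fst p) + F (snd p)) / 2) \<partial>?P)"
    by (simp add: nn_integral_cmult nn_integral_divide nn_integral_add F_def)
  also have "\<dots> \<le> (\<integral>\<^sup>+p. ennreal (D u p * R p powr (1 / 2 + \<epsilon>)) * tau G \<mu> act \<nu> \<epsilon> n \<partial>?P)"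
  proof (rule nn_integral_mono_AE)
    have "AE x in \<nu>. F x \<le> tau G \<mu> act \<nu> \<epsilon> n"
      unfolding tau_def F_def S_def \<sigma>_def by (rule esssup_AE)
    from AE_pair_fst_snd[OF this]
    show "AE p in ?P. ennreal (D u p * R p powr (1 / 2 + \<epsilon>)) * ((F (fst p) + F (snd p)) / 2)
        \<le> ennreal (D u p * R p powr (1 / 2 + \<epsilon>)) * tau G \<mu> act \<nu> \<epsilon> n"
    proof eventually_elim
      case (elim p)
      have "(F (fst p) + F (snd p)) / 2 \<le> (tau G \<mu> act \<nu> \<epsilon> n + tau G \<mu> act \<nu> \<epsilon> n) / 2"
        using elim by (intro divide_right_mono_ennreal add_mono) auto
      also have "\<dots> = tau G \<mu> act \<nu> \<epsilon> n"
        by (simp add: mult_2_right[symmetric] mult_divide_eq_ennreal)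
      finally show ?case
        by (rule mult_left_mono) simp
    qed
  qed
  \<comment> \<open>The constant may be infinite here: in \<open>ennreal\<close> the product of
    \<open>\<infinity>\<close> and \<open>0\<close> is \<open>0\<close>, as the statement
    prescribes.\<close>
  also have "\<dots> = N_seminorm \<nu> \<rho> \<epsilon> u * tau G \<mu> act \<nu> \<epsilon> n"
    unfolding N by (rule nn_integral_multc) measurable
  finally show ?thesis
    by (simp only: mult.commute)
qed

end

theorem proposition4p2:
  fixes G :: "('g, 'm) monoid_scheme"
    and \<mu> :: "'g pmf"
    and act :: "'g \<Rightarrow> 'x::topological_space \<Rightarrow> 'x"
    and \<nu> :: "'x measure"
    and \<rho> :: "'x \<times> 'x \<Rightarrow> real"
    and \<epsilon> :: real
    and n :: nat
    and u :: "'x \<Rightarrow> 'k::{real_normed_field, banach, second_countable_topology}"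
  assumes "compact_measured_group_space G \<mu> act \<nu>"
    and "nonatomic \<nu>"
    and "product_current G act \<nu> \<rho>"
    and "\<epsilon> > 0"
    and "n \<ge> 1"
    and "u \<in> B_space \<nu> \<rho> \<epsilon>"
  shows "N_seminorm \<nu> \<rho> \<epsilon> ((conv_operator G act \<mu> ^^ n) u)
    \<le> tau G \<mu> act \<nu> \<epsilon> n * N_seminorm \<nu> \<rho> \<epsilon> u"
proof -
  interpret compact_measured_group_space G \<mu> act \<nu>
    by fact
  show ?thesis
    using assms by (intro N_seminorm_conv_operator_power_le) (auto simp: B_space_def)
qed

end
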